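(* Let $L$ be a full-rank lattice in $\mathbb{R}^n$, $b>0$, and let $H$ be a $k$-dimensional hyperplane (linear subspace) of $\mathbb{R}^n$ with $1\le k<n$. Then $$|L\cap H\cap[0,b)^n|\le\frac{n^{k/2}(b+2\nu(L))^k(2\nu(L))^{n-k}}{\det(L)}.$$
   Context: $\nu(L)$ is the covering radius of $L$ with respect to the Euclidean norm, and $\det(L)$ the covolume of $L$. *)

theory Defs
  imports "HOL-Analysis.Analysis"
begin

text \<open>The lattice generated by a family of vectors indexed by the finite type 'n.\<close>
definition lattice_gen :: "('n::finite \<Rightarrow> real^'n) \<Rightarrow> (real^'n) set" where
  "lattice_gen bs = {(\<Sum>i\<in>UNIV. of_int (z i) *\<^sub>R bs i) | z. True}"

text \<open>bs is a basis of the full-rank lattice L: n linearly independent vectors generating L.\<close>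
definition is_lattice_basis :: "('n::finite \<Rightarrow> real^'n) \<Rightarrow> (real^'n) set \<Rightarrow> bool" where
  "is_lattice_basis bs L \<longleftrightarrow> inj bs \<and> independent (range bs) \<and> L = lattice_gen bs"

definition full_rank_lattice :: "(real^'n::finite) set \<Rightarrow> bool" where
  "full_rank_lattice L \<longleftrightarrow> (\<exists>bs. is_lattice_basis bs L)"

text \<open>Covolume det(L) = |det B| for any basis B (rows = basis vectors).\<close>
definition covolume :: "(real^'n::finite) set \<Rightarrow> real" where
  "covolume L = \<bar>det (\<chi> i j. (SOME bs. is_lattice_basis bs L) i $ j)\<bar>"

text \<open>Covering radius w.r.t. the Euclidean norm: sup over x of dist(x, L).\<close>
definition covering_radius :: "(real^'n::finite) set \<Rightarrow> real" where
  "covering_radius L = (SUP x\<in>UNIV. infdist x L)"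

end

theory Submission
  imports Defs
begin

text \<open>
  The Voronoi cells of the lattice points are pairwise disjoint translates of the cell of 0, each
  contained in the ball of radius \<open>\<nu>(L)\<close> around its centre, and each of volume at least
  \<open>det(L)\<close>: cutting the fundamental parallelepiped along the cells and translating the pieces back
  packs it into the cell of 0 without overlap. So the number of lattice points in
  \<open>H \<inter> [0,b)\<^sup>n\<close> times \<open>det(L)\<close> is at most the volume of the \<open>\<nu>(L)\<close>-neighbourhood of
  \<open>H \<inter> [0,b]\<^sup>n\<close>. In orthonormal coordinates adapted to \<open>H\<close> this neighbourhood lies in a box
  with \<open>k\<close> sides of length at most \<open>\<surd>n (b + 2\<nu>(L))\<close> and \<open>n - k\<close> sides of length \<open>2\<nu>(L)\<close>.
\<close>

lemma measure_swap_coordinates_image: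
  fixes S :: "(real^'n::finite) set" and m n :: 'n
  assumes "S \<in> lmeasurable"
  shows "(\<lambda>x. \<chi> i. x $ Transposition.transpose m n i) ` S \<in> lmeasurable \<and>
    measure lebesgue ((\<lambda>x. \<chi> i. x $ Transposition.transpose m n i) ` S) =
    \<bar>det (matrix (\<lambda>x. \<chi> i. x $ Transposition.transpose m n i))\<bar> * measure lebesgue S"
    (is "?h ` S \<in> _ \<and> _")
proof -
  have swap_matrix: "matrix ?h = transpose (\<chi> i j. mat 1 $ i $ Transposition.transpose m n j)"
    by (auto simp: matrix_def transpose_def axis_def mat_def vec_eq_iff Transposition.transpose_def)
  have det: "\<bar>det (matrix ?h)\<bar> = 1"
    unfolding swap_matrix det_transpose det_permute_columns [OF permutes_swap_id [OF UNIV_I UNIV_I]]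
    by (simp add: sign_swap_id)
  have lin: "linear ?h"
    by (rule linearI) (simp_all add: vec_eq_iff)
  have "measure lebesgue (?h ` cbox a b) = measure lebesgue (cbox a b)" for a b
  proof (cases "cbox a b = {}")
    case False
    have box: "?h ` cbox a b = cbox (?h a) (?h b)"
      by (auto simp: image_iff lambda_swap_Galois mem_box_cart) (metis transpose_involutory)+
    moreover have "cbox (?h a) (?h b) \<noteq> {}"
      using False by (simp flip: box)
    ultimately show ?thesis
      using False prod.permute [OF permutes_swap_id, where S=UNIV and g="\<lambda>i. (b - a) $ i"]
      by (simp add: box content_cbox_cart o_def)
  qed simp
  then show ?thesis
    using measure_linear_sufficient [OF lin assms, of 1] det by simp
qed

lemma measure_shear_image:
  fixes S :: "(real^'n::finite) set" and m n :: 'n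
  assumes "m \<noteq> n" "S \<in> lmeasurable"
  shows "(\<lambda>x. \<chi> i. if i = m then x $ m + x $ n else x $ i) ` S \<in> lmeasurable \<and>
    measure lebesgue ((\<lambda>x. \<chi> i. if i = m then x $ m + x $ n else x $ i) ` S) =
    \<bar>det (matrix (\<lambda>x. \<chi> i. if i = m then x $ m + x $ n else x $ i))\<bar> * measure lebesgue S"
proof -
  define h :: "real^'n \<Rightarrow> real^'n" where "h = (\<lambda>x. \<chi> i. if i = m then x $ m + x $ n else x $ i)"
  have shear_matrix: "matrix h = (\<chi> k. if k = m then row m (mat 1) + 1 *s row n (mat 1) else row k (mat 1))"
    by (auto simp: h_def matrix_def axis_def row_def mat_def vec_eq_iff)
  have det: "det (matrix h) = 1"
    unfolding shear_matrix det_row_operation [OF assms(1)] by simp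
  have lin: "linear h"
    unfolding h_def by (rule linearI) (auto simp: vec_eq_iff algebra_simps)
  have "measure lebesgue (h ` cbox a b) = measure lebesgue (cbox a b)" for a b
  proof (cases "cbox a b = {}")
    case False
    \<comment> \<open>The library computes the shear of boxes with nonnegative n-th coordinates; translate there.\<close>
    define t :: "real^'n" where "t = (\<chi> i. if i = n then - a $ n else 0)"
    have "h ` cbox a b = (+) (h (- t)) ` h ` (+) t ` cbox a b"
      by (simp add: image_image linear_add[OF lin] linear_neg[OF lin])
    then have "measure lebesgue (h ` cbox a b) = measure lebesgue (h ` cbox (t + a) (t + b))"
      by (simp add: measure_translation cbox_translation)
    also have "\<dots> = measure lebesgue (cbox (t + a) (t + b))"
    proof (unfold h_def, rule measure_shear_interval [OF assms(1)])
      show "cbox (t + a) (t + b) \<noteq> {}"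
        using False by (metis cbox_translation image_is_empty)
    qed (simp add: t_def)
    also have "\<dots> = measure lebesgue (cbox a b)"
      by (metis cbox_translation measure_translation)
    finally show ?thesis .
  qed simp
  then show ?thesis
    using measure_linear_sufficient [OF lin assms(2), of 1] det by (simp add: h_def)
qed

text \<open>The library's \<open>measure_linear_image\<close> requires a well-ordered index type; the induction
  over elementary linear maps only needs finiteness.\<close>

lemma measure_linear_image_cart:
  fixes f :: "real^'n::finite \<Rightarrow> real^'n"
  assumes "linear f" "S \<in> lmeasurable"
  shows "f ` S \<in> lmeasurable \<and> measure lebesgue (f ` S) = \<bar>det (matrix f)\<bar> * measure lebesgue S"
proof -
  have "\<forall>S \<in> lmeasurable. f ` S \<in> lmeasurable \<and>
          measure lebesgue (f ` S) = \<bar>det (matrix f)\<bar> * measure lebesgue S" (is "?P f")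
  proof (rule induct_linear_elementary [OF \<open>linear f\<close>])
    show "?P (f \<circ> g)" if "linear f" "linear g" "?P f" "?P g" for f g :: "real^'n \<Rightarrow> real^'n"
    proof
      fix S :: "(real^'n) set"
      assume "S \<in> lmeasurable"
      then have "g ` S \<in> lmeasurable"
        using \<open>?P g\<close> by blast
      then show "(f \<circ> g) ` S \<in> lmeasurable \<and>
        measure lebesgue ((f \<circ> g) ` S) = \<bar>det (matrix (f \<circ> g))\<bar> * measure lebesgue S"
        using that(3) [rule_format, of "g ` S"] that(4) [rule_format, OF \<open>S \<in> lmeasurable\<close>]
        by (simp add: image_comp matrix_compose [OF that(2,1)] det_mul abs_mult)
    qed
  next
    fix f :: "real^'n \<Rightarrow> real^'n" and i
    assume "linear f" "\<And>x. f x $ i = 0"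
    then have "\<not> surj f"
      by (metis one_neq_zero surjE vec_component)
    then have "\<not> inj f"
      using \<open>linear f\<close> linear_injective_imp_surjective by blast
    then show "?P f"
      using negligible_linear_singular_image [OF \<open>linear f\<close>] det_nz_iff_inj [OF \<open>linear f\<close>]
      by (simp add: negligible_imp_measurable negligible_imp_measure0)
  next
    fix c :: "'n \<Rightarrow> real"
    have "matrix (\<lambda>x. \<chi> i. c i * x $ i) = (\<chi> i j. if i = j then c i else 0)"
      by (simp add: matrix_def axis_def vec_eq_iff)
    then show "?P (\<lambda>x. \<chi> i. c i * x $ i)"
      by (simp add: measurable_stretch measure_stretch det_diagonal)
  next
    show "?P (\<lambda>x. \<chi> i. x $ Transposition.transpose m n i)" for m n :: 'n
      using measure_swap_coordinates_image by blast
  next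
    show "?P (\<lambda>x. \<chi> i. if i = m then x $ m + x $ n else x $ i)" if "m \<noteq> n" for m n :: 'n
      using measure_shear_image [OF that] by blast
  qed
  with assms(2) show ?thesis
    by blast
qed

lemma vec_nth_One [simp]: "(One :: real^'n::finite) $ i = 1"
  by (simp add: cart_eq_inner_axis)

definition basis_map :: "('n::finite \<Rightarrow> real^'n) \<Rightarrow> real^'n \<Rightarrow> real^'n" where
  "basis_map bs t = (\<Sum>i\<in>UNIV. t $ i *\<^sub>R bs i)"

lemma linear_basis_map: "linear (basis_map bs)"
  by (rule linearI) (simp_all add: basis_map_def scaleR_add_left sum.distrib scaleR_sum_right)

lemma matrix_basis_map: "matrix (basis_map bs) = transpose (\<chi> i j. bs i $ j)"
proof -
  have "basis_map bs (axis j 1) = bs j" for j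
    by (simp add: basis_map_def axis_def if_distrib [of "\<lambda>c. c *\<^sub>R _"] cong: if_cong)
  then show ?thesis
    by (simp add: matrix_def transpose_def)
qed

lemma integer_vectors_eq_range:
  "{t::real^'n::finite. \<forall>i. t $ i \<in> \<int>} = range (\<lambda>z. \<chi> i. of_int (z i))"
proof (intro set_eqI iffI)
  fix t :: "real^'n"
  assume "t \<in> {t. \<forall>i. t $ i \<in> \<int>}"
  then have "t = (\<chi> i. of_int \<lfloor>t $ i\<rfloor>)"
    by (simp add: vec_eq_iff)
  then show "t \<in> range (\<lambda>z. \<chi> i. of_int (z i))"
    by (rule range_eqI [where x="\<lambda>i. \<lfloor>t $ i\<rfloor>"])
qed auto

lemma lattice_gen_eq_basis_map_image: "lattice_gen bs = basis_map bs ` {t. \<forall>i. t $ i \<in> \<int>}"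
  unfolding lattice_gen_def integer_vectors_eq_range image_image
  by (simp add: basis_map_def full_SetCompr_eq)

lemma finite_integer_vectors_in_cball:
  "finite {t::real^'n::finite. (\<forall>i. t $ i \<in> \<int>) \<and> norm t \<le> R}"
proof (rule finite_subset)
  let ?N = "\<lceil>R\<rceil>"
  show "{t::real^'n. (\<forall>i. t $ i \<in> \<int>) \<and> norm t \<le> R}
      \<subseteq> (\<lambda>z. \<chi> i. of_int (z i)) ` (UNIV \<rightarrow>\<^sub>E {-?N..?N})"
  proof
    fix t :: "real^'n"
    assume t: "t \<in> {t. (\<forall>i. t $ i \<in> \<int>) \<and> norm t \<le> R}"
    have "-?N \<le> \<lfloor>t $ i\<rfloor> \<and> \<lfloor>t $ i\<rfloor> \<le> ?N" for i
    proof -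
      have "-R \<le> t $ i" "t $ i \<le> R"
        using t component_le_norm_cart [of t i] by auto
      then have "\<lfloor>-R\<rfloor> \<le> \<lfloor>t $ i\<rfloor>" "\<lfloor>t $ i\<rfloor> \<le> \<lfloor>R\<rfloor>"
        by (simp_all add: floor_mono)
      then show ?thesis
        by (simp add: floor_minus) (meson floor_le_ceiling order_trans)
    qed
    moreover have "t = (\<chi> i. of_int \<lfloor>t $ i\<rfloor>)"
      using t by (simp add: vec_eq_iff)
    ultimately show "t \<in> (\<lambda>z. \<chi> i. of_int (z i)) ` (UNIV \<rightarrow>\<^sub>E {-?N..?N})"
      by (intro image_eqI [where x="\<lambda>i. \<lfloor>t $ i\<rfloor>"]) auto
  qed
qed (intro finite_imageI finite_PiE; simp)

locale lattice_basis =
  fixes bs :: "'n::finite \<Rightarrow> real^'n" and L :: "(real^'n) set"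
  assumes is_basis: "is_lattice_basis bs L"
begin

lemma inj_basis_map: "inj (basis_map bs)"
proof -
  have "t = 0" if "basis_map bs t = 0" for t
  proof (rule ccontr)
    assume "t \<noteq> 0"
    then obtain i where "t $ i \<noteq> 0"
      by (auto simp: vec_eq_iff)
    have "inj bs" "independent (range bs)"
      using is_basis by (auto simp: is_lattice_basis_def)
    moreover have "(\<Sum>v\<in>range bs. t $ inv bs v *\<^sub>R v) = basis_map bs t"
      using \<open>inj bs\<close> by (simp add: sum.reindex basis_map_def)
    then have "dependent (range bs)"
      unfolding dependent_finite [OF finite_imageI [OF finite_class.finite_UNIV]]
      using \<open>inj bs\<close> \<open>t $ i \<noteq> 0\<close> that by (intro exI [of _ "\<lambda>v. t $ inv bs v"]) auto
    ultimately show False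
      by blast
  qed
  then show ?thesis
    by (simp add: linear_basis_map linear_injective_0)
qed

definition coords :: "real^'n \<Rightarrow> real^'n" where
  "coords = inv (basis_map bs)"

lemma linear_coords: "linear coords"
  unfolding coords_def by (rule inj_linear_imp_inv_linear [OF linear_basis_map inj_basis_map])

lemma coords_basis_map [simp]: "coords (basis_map bs t) = t"
  by (simp add: coords_def inj_basis_map)

lemma basis_map_coords [simp]: "basis_map bs (coords x) = x"
  using linear_injective_imp_surjective [OF linear_basis_map inj_basis_map]
  by (simp add: coords_def surj_f_inv_f)

lemma lattice_eq: "L = basis_map bs ` {t. \<forall>i. t $ i \<in> \<int>}"
  using is_basis by (simp add: is_lattice_basis_def lattice_gen_eq_basis_map_image)

lemma mem_lattice_iff: "v \<in> L \<longleftrightarrow> (\<forall>i. coords v $ i \<in> \<int>)"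
  by (auto simp: lattice_eq image_iff intro: exI [of _ "coords v"])

lemma zero_in_lattice: "0 \<in> L"
  by (simp add: mem_lattice_iff linear_0 [OF linear_coords])

lemma lattice_add: "v \<in> L \<Longrightarrow> w \<in> L \<Longrightarrow> v + w \<in> L"
  by (simp add: mem_lattice_iff linear_add [OF linear_coords])

lemma lattice_diff: "v \<in> L \<Longrightarrow> w \<in> L \<Longrightarrow> v - w \<in> L"
  by (simp add: mem_lattice_iff linear_diff [OF linear_coords])

lemma countable_lattice: "countable L"
  by (simp add: lattice_eq integer_vectors_eq_range)

lemma finite_lattice_inter_cball: "finite (L \<inter> cball y r)"
proof -
  obtain K where K: "\<And>x. norm (coords x) \<le> K * norm x" "K > 0"
    using linear_bounded_pos [OF linear_coords] by blast
  have "coords ` (L \<inter> cball y r) \<subseteq> {t. (\<forall>i. t $ i \<in> \<int>) \<and> norm t \<le> K * (norm y + r)}"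
  proof clarify
    fix v assume "v \<in> L" "v \<in> cball y r"
    then have "norm v \<le> norm y + r"
      using norm_triangle_sub [of v y] by (simp add: dist_norm norm_minus_commute)
    then have "norm (coords v) \<le> K * (norm y + r)"
      using K by (smt (verit) mult_left_mono)
    then show "(\<forall>i. coords v $ i \<in> \<int>) \<and> norm (coords v) \<le> K * (norm y + r)"
      using \<open>v \<in> L\<close> by (simp add: mem_lattice_iff)
  qed
  then have "finite (coords ` (L \<inter> cball y r))"
    using finite_integer_vectors_in_cball finite_subset by blast
  then show ?thesis
    by (rule finite_imageD) (rule inj_on_inverseI [where g="basis_map bs"], simp)
qed

lemma infdist_le_sum_norm_basis: "infdist x L \<le> (\<Sum>i\<in>UNIV. norm (bs i))"
proof -
  define v where "v = basis_map bs (\<chi> i. of_int \<lfloor>coords x $ i\<rfloor>)"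
  define t where "t = coords x - (\<chi> i. of_int \<lfloor>coords x $ i\<rfloor>)"
  have "v \<in> L"
    by (simp add: v_def mem_lattice_iff)
  have "x - v = basis_map bs t"
    by (simp add: v_def t_def linear_diff [OF linear_basis_map])
  then have "dist x v \<le> (\<Sum>i\<in>UNIV. norm (t $ i *\<^sub>R bs i))"
    unfolding dist_norm basis_map_def by (metis norm_sum)
  also have "\<dots> \<le> (\<Sum>i\<in>UNIV. norm (bs i))"
  proof (rule sum_mono)
    fix i
    have "\<bar>t $ i\<bar> \<le> 1"
      unfolding t_def by simp linarith
    then show "norm (t $ i *\<^sub>R bs i) \<le> norm (bs i)"
      by (simp add: mult_left_le_one_le)
  qed
  finally show ?thesis
    using infdist_le2 [OF \<open>v \<in> L\<close>] by blast
qed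

lemma infdist_le_covering_radius: "infdist x L \<le> covering_radius L"
  unfolding covering_radius_def
  by (rule cSUP_upper) (auto intro!: bdd_aboveI2 infdist_le_sum_norm_basis)

lemma covering_radius_nonneg: "0 \<le> covering_radius L"
  using infdist_le_covering_radius [of 0] infdist_nonneg [of 0 L] by linarith

end

lemma measure_le_by_translated_pieces:
  fixes P V :: "'a::euclidean_space set" and C :: "'a \<Rightarrow> 'a set"
  assumes "countable I" "P \<in> lmeasurable" "V \<in> lmeasurable"
    and C: "\<And>v. C v \<in> sets lebesgue" "disjoint_family_on C I"
    and "negligible (P - (\<Union>v\<in>I. C v))"
    and "disjoint_family_on (\<lambda>v. (\<lambda>x. x - v) ` (P \<inter> C v)) I"
    and "\<And>v. v \<in> I \<Longrightarrow> (\<lambda>x. x - v) ` (P \<inter> C v) \<subseteq> V"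
  shows "measure lebesgue P \<le> measure lebesgue V"
proof -
  define A where "A v = P \<inter> C v" for v
  define B where "B v = (\<lambda>x. x - v) ` A v" for v
  have A: "A v \<in> lmeasurable" for v
    unfolding A_def using assms(2) C(1) by (rule fmeasurable_Int_fmeasurable)
  then have B: "B v \<in> lmeasurable" "emeasure lebesgue (B v) = emeasure lebesgue (A v)" for v
    by (simp_all add: B_def measurable_translation_subtract emeasure_eq_measure2
        measure_translation_subtract)
  have sets_A: "A v \<in> sets lebesgue" and sets_B: "B v \<in> sets lebesgue" for v
    using A B(1) by (simp_all add: fmeasurable_def)
  have "disjoint_family_on A I"
    using C(2) by (auto simp: disjoint_family_on_def A_def)
  have null: "P - (\<Union>v\<in>I. C v) \<in> null_sets lebesgue"
    using assms(6) negligible_iff_null_sets by blast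
  have sets_UA: "(\<Union>v\<in>I. A v) \<in> sets lebesgue"
    using assms(1) sets_A by (rule sets.countable_UN'')
  have "emeasure lebesgue P \<le> emeasure lebesgue ((\<Union>v\<in>I. A v) \<union> (P - (\<Union>v\<in>I. C v)))"
    using sets_UA null by (intro emeasure_mono) (auto simp: A_def)
  also have "\<dots> = emeasure lebesgue (\<Union>v\<in>I. A v)"
    using sets_UA null by (rule emeasure_Un_null_set)
  also have "\<dots> = (\<integral>\<^sup>+v. emeasure lebesgue (A v) \<partial>count_space I)"
    using sets_A assms(1) \<open>disjoint_family_on A I\<close> by (rule emeasure_UN_countable)
  also have "\<dots> = (\<integral>\<^sup>+v. emeasure lebesgue (B v) \<partial>count_space I)"
    using B(2) by simp
  also have "\<dots> = emeasure lebesgue (\<Union>v\<in>I. B v)"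
    using sets_B assms(1,7) by (intro emeasure_UN_countable [symmetric]) (simp_all add: B_def A_def)
  also have "\<dots> \<le> emeasure lebesgue V"
    using assms(3,8) by (intro emeasure_mono) (auto simp: B_def A_def fmeasurable_def)
  finally show ?thesis
    using assms(2,3) by (simp add: emeasure_eq_measure2)
qed

definition voronoi_cell :: "'a::metric_space set \<Rightarrow> 'a \<Rightarrow> 'a set" where
  "voronoi_cell L v = {y. \<forall>w\<in>L. w \<noteq> v \<longrightarrow> dist y v < dist y w}"

lemma voronoi_cells_disjoint:
  "v \<in> L \<Longrightarrow> w \<in> L \<Longrightarrow> v \<noteq> w \<Longrightarrow> disjnt (voronoi_cell L v) (voronoi_cell L w)"
  unfolding voronoi_cell_def disjnt_def by fastforce

lemma infdist_voronoi_cell: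
  assumes "v \<in> L" "y \<in> voronoi_cell L v"
  shows "infdist y L = dist y v"
proof -
  have "dist y v \<le> dist y w" if "w \<in> L" for w
    using assms that unfolding voronoi_cell_def by (cases "w = v") auto
  then show ?thesis
    using assms(1) by (auto simp: infdist_def intro!: cInf_eq_minimum)
qed

lemma voronoi_cell_sets_lebesgue:
  fixes L :: "'a::euclidean_space set"
  assumes "countable L"
  shows "voronoi_cell L v \<in> sets lebesgue"
proof -
  have "voronoi_cell L v = (\<Inter>w\<in>L - {v}. {y. dist y v < dist y w})"
    unfolding voronoi_cell_def by auto
  moreover have "open {y. dist y v < dist y w}" for w
    by (intro open_Collect_less continuous_intros)
  then have "{y. dist y v < dist y w} \<in> sets lebesgue" for w
    by (metis borel_open sets_completionI_sets sets_lborel)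
  ultimately show ?thesis
    using assms by (auto intro!: sets.countable_INT'')
qed

context lattice_basis
begin

lemma lattice_translate_eq:
  assumes "v \<in> L"
  shows "(\<lambda>u. u + v) ` L = L"
proof
  show "L \<subseteq> (\<lambda>u. u + v) ` L"
    using assms lattice_diff by (force intro: image_eqI [where x="_ - v"])
qed (use assms lattice_add in auto)

lemma voronoi_cell_translate:
  assumes "v \<in> L"
  shows "voronoi_cell L v = (+) v ` voronoi_cell L 0"
proof -
  have "y \<in> voronoi_cell L v \<longleftrightarrow> y - v \<in> voronoi_cell L 0" for y
  proof -
    have "y \<in> voronoi_cell L v \<longleftrightarrow> (\<forall>w\<in>(\<lambda>u. u + v) ` L. w \<noteq> v \<longrightarrow> dist y v < dist y w)"
      by (simp add: voronoi_cell_def lattice_translate_eq [OF assms])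
    then show ?thesis
      by (simp add: voronoi_cell_def dist_norm algebra_simps)
  qed
  then show ?thesis
    by (force intro: image_eqI [where x="_ - v"])
qed

lemma dist_le_covering_radius:
  "v \<in> L \<Longrightarrow> y \<in> voronoi_cell L v \<Longrightarrow> dist y v \<le> covering_radius L"
  using infdist_voronoi_cell infdist_le_covering_radius by metis

lemma voronoi_cell_lmeasurable:
  assumes "v \<in> L"
  shows "voronoi_cell L v \<in> lmeasurable"
proof (rule bounded_set_imp_lmeasurable)
  show "bounded (voronoi_cell L v)"
    using dist_le_covering_radius [OF assms]
    by (intro bounded_subset [OF bounded_cball [of v "covering_radius L"]]) (auto simp: dist_commute)
qed (rule voronoi_cell_sets_lebesgue [OF countable_lattice])

lemma measure_voronoi_cell:
  "v \<in> L \<Longrightarrow> measure lebesgue (voronoi_cell L v) = measure lebesgue (voronoi_cell L 0)"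
  by (simp add: voronoi_cell_translate measure_translation)

lemma exists_nearest_lattice_point: "\<exists>v\<in>L. \<forall>w\<in>L. dist y v \<le> dist y w"
proof -
  \<comment> \<open>Only the finitely many lattice points at most as far from y as 0 are candidates.\<close>
  define F where "F = L \<inter> cball y (norm y)"
  have "finite F" "0 \<in> F"
    using finite_lattice_inter_cball zero_in_lattice by (auto simp: F_def)
  then obtain v where "v \<in> F" and v: "\<And>w. w \<in> F \<Longrightarrow> dist y v \<le> dist y w"
    using ex_is_arg_min_if_finite [of F "dist y"] by (auto simp: is_arg_min_linorder)
  have "dist y v \<le> dist y w" if "w \<in> L" for w
  proof (cases "w \<in> F")
    case False
    then have "norm y < dist y w"
      using that by (auto simp: F_def dist_commute)
    then show ?thesis
      using \<open>v \<in> F\<close> by (auto simp: F_def dist_commute)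
  qed (rule v)
  then show ?thesis
    using \<open>v \<in> F\<close> by (auto simp: F_def)
qed

lemma negligible_outside_voronoi_cells: "negligible (- (\<Union>v\<in>L. voronoi_cell L v))"
proof (rule negligible_subset)
  \<comment> \<open>A point without a cell has two distinct nearest lattice points.\<close>
  show "negligible (\<Union>(v, w)\<in>L \<times> L - Id. {y. dist y v = dist y w})"
  proof (rule negligible_countable_Union)
    show "countable ((\<lambda>(v, w). {y. dist y v = dist y w}) ` (L \<times> L - Id))"
      using countable_lattice by (intro countable_image countable_Diff countable_SIGMA) auto
  next
    fix S
    assume "S \<in> (\<lambda>(v, w). {y. dist y v = dist y w}) ` (L \<times> L - Id)"
    then obtain v w where "v \<noteq> w" and S: "S = {y. dist y v = dist y w}"
      by auto
    have "S = {y. (2 *\<^sub>R (w - v)) \<bullet> y = w \<bullet> w - v \<bullet> v}"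
      unfolding S dist_norm norm_eq by (auto simp: algebra_simps inner_commute)
    then show "negligible S"
      using \<open>v \<noteq> w\<close> negligible_hyperplane [of "2 *\<^sub>R (w - v)" "w \<bullet> w - v \<bullet> v"] by simp
  qed
  show "- (\<Union>v\<in>L. voronoi_cell L v) \<subseteq> (\<Union>(v, w)\<in>L \<times> L - Id. {y. dist y v = dist y w})"
  proof
    fix y
    assume "y \<in> - (\<Union>v\<in>L. voronoi_cell L v)"
    moreover obtain v where "v \<in> L" and v: "\<forall>w\<in>L. dist y v \<le> dist y w"
      using exists_nearest_lattice_point by blast
    ultimately obtain w where "w \<in> L" "w \<noteq> v" "dist y v = dist y w"
      by (force simp: voronoi_cell_def not_less dest: order_antisym)
    with \<open>v \<in> L\<close> show "y \<in> (\<Union>(v, w)\<in>L \<times> L - Id. {y. dist y v = dist y w})"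
      by blast
  qed
qed

lemma parallelepiped_translates_disjoint:
  assumes "v \<in> L" "w \<in> L"
    and "x + v \<in> basis_map bs ` box 0 One" "x + w \<in> basis_map bs ` box 0 One"
  shows "v = w"
proof -
  have coords_box: "0 < coords u $ i \<and> coords u $ i < 1" if u: "u \<in> basis_map bs ` box 0 One" for u i
  proof -
    obtain t where "t \<in> box 0 One" "u = basis_map bs t"
      using u by blast
    then show ?thesis
      unfolding mem_box_cart vec_nth_One by simp
  qed
  have "coords (v - w) $ i = 0" for i
  proof -
    have "coords (v - w) $ i = coords (x + v) $ i - coords (x + w) $ i"
      by (simp add: linear_diff [OF linear_coords] linear_add [OF linear_coords])
    then have "\<bar>coords (v - w) $ i\<bar> < 1"
      using coords_box [OF assms(3), of i] coords_box [OF assms(4), of i] by linarith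
    moreover have "coords (v - w) $ i \<in> \<int>"
      using lattice_diff [OF assms(1,2)] mem_lattice_iff by blast
    ultimately show ?thesis
      using Ints_nonzero_abs_less1 by blast
  qed
  then have "basis_map bs (coords (v - w)) = 0"
    by (simp add: vec_eq_iff basis_map_def)
  then show ?thesis
    by simp
qed

lemma det_le_measure_voronoi_cell:
  "\<bar>det (matrix (basis_map bs))\<bar> \<le> measure lebesgue (voronoi_cell L 0)"
proof -
  \<comment> \<open>Cut the fundamental parallelepiped along the Voronoi cells and translate the pieces back
     into the cell of 0; they do not overlap there because the translates of P do not.\<close>
  define P where "P = basis_map bs ` box 0 One"
  have "measure lebesgue (box 0 (One :: real^'n)) = 1"
    by (subst measure_completion) (simp_all add: measure_lborel_box_eq)
  then have P: "P \<in> lmeasurable" "measure lebesgue P = \<bar>det (matrix (basis_map bs))\<bar>"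
    using measure_linear_image_cart [OF linear_basis_map [of bs] lmeasurable_box [of 0 One]]
    by (simp_all add: P_def)
  have "measure lebesgue P \<le> measure lebesgue (voronoi_cell L 0)"
  proof (rule measure_le_by_translated_pieces [OF countable_lattice P(1)])
    show "voronoi_cell L 0 \<in> lmeasurable" "voronoi_cell L v \<in> sets lebesgue" for v
      by (simp_all add: voronoi_cell_lmeasurable zero_in_lattice voronoi_cell_sets_lebesgue
          countable_lattice)
    show "disjoint_family_on (voronoi_cell L) L"
      using voronoi_cells_disjoint by (auto simp: disjoint_family_on_def disjnt_def)
    show "negligible (P - (\<Union>v\<in>L. voronoi_cell L v))"
      using negligible_outside_voronoi_cells by (rule negligible_subset) blast
    show "(\<lambda>x. x - v) ` (P \<inter> voronoi_cell L v) \<subseteq> voronoi_cell L 0" if "v \<in> L" for v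
      using voronoi_cell_translate [OF that] by auto
    show "disjoint_family_on (\<lambda>v. (\<lambda>x. x - v) ` (P \<inter> voronoi_cell L v)) L"
    proof (unfold disjoint_family_on_def, intro ballI impI)
      fix v w
      assume "v \<in> L" "w \<in> L" "v \<noteq> w"
      have "x + u \<in> P" if "x \<in> (\<lambda>x. x - u) ` (P \<inter> voronoi_cell L u)" for x u
        using that by auto
      then show "(\<lambda>x. x - v) ` (P \<inter> voronoi_cell L v) \<inter> (\<lambda>x. x - w) ` (P \<inter> voronoi_cell L w) = {}"
        using parallelepiped_translates_disjoint [OF \<open>v \<in> L\<close> \<open>w \<in> L\<close>] \<open>v \<noteq> w\<close>
        unfolding P_def by blast
    qed
  qed
  with P(2) show ?thesis
    by simp
qed

end

lemma dim_orthogonal_comp: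
  fixes H :: "'a::euclidean_space set"
  assumes "subspace H"
  shows "dim (H\<^sup>\<bottom>) = DIM('a) - dim H"
proof -
  have orth: "x \<bullet> y = 0" if "x \<in> H" "y \<in> H\<^sup>\<bottom>" for x y
    using that by (simp add: orthogonal_comp_def orthogonal_def)
  have "x \<in> span (H \<union> H\<^sup>\<bottom>)" for x
  proof -
    have "x \<in> H + H\<^sup>\<bottom>"
      using subspace_sum_orthogonal_comp [OF assms] by simp
    then obtain h w where "h \<in> H" "w \<in> H\<^sup>\<bottom>" "x = h + w"
      by (auto elim: set_plus_elim)
    then show ?thesis
      by (metis UnCI span_add span_base)
  qed
  then have "dim (H \<union> H\<^sup>\<bottom>) = DIM('a)"
    by (metis dim_UNIV dim_span subsetI subset_UNIV subset_antisym)
  then show ?thesis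
    using dim_orthogonal_sum [OF orth] by simp
qed

lemma orthonormal_basis_adapted_to_subspace:
  fixes H :: "'a::euclidean_space set"
  assumes "subspace H"
  obtains BH BW where "BH \<subseteq> H" "BW \<subseteq> H\<^sup>\<bottom>" "card BH = dim H" "card (BH \<union> BW) = DIM('a)"
    "pairwise orthogonal (BH \<union> BW)" "\<And>x. x \<in> BH \<union> BW \<Longrightarrow> norm x = 1"
proof -
  obtain BH where BH: "BH \<subseteq> H" "pairwise orthogonal BH" "\<And>x. x \<in> BH \<Longrightarrow> norm x = 1"
    "independent BH" "card BH = dim H"
    using orthonormal_basis_subspace [OF assms] by metis
  obtain BW where BW: "BW \<subseteq> H\<^sup>\<bottom>" "pairwise orthogonal BW" "\<And>x. x \<in> BW \<Longrightarrow> norm x = 1"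
    "independent BW" "card BW = DIM('a) - dim H"
    using orthonormal_basis_subspace [OF subspace_orthogonal_comp] dim_orthogonal_comp [OF assms]
    by metis
  have orth: "orthogonal x y" if "x \<in> BH" "y \<in> BW" for x y
    using that BH(1) BW(1) by (auto simp: orthogonal_comp_def)
  have "finite BH" "finite BW"
    using BH(4) BW(4) independent_imp_finite by blast+
  moreover have "BH \<inter> BW = {}"
    using orth BH(3) by (fastforce simp: orthogonal_def)
  ultimately have "card (BH \<union> BW) = DIM('a)"
    using BH(5) BW(5) dim_subset_UNIV [of H] by (simp add: card_Un_disjoint)
  moreover have "pairwise orthogonal (BH \<union> BW)"
    using BH(2) BW(2) orth by (auto simp: pairwise_def) (meson orth orthogonal_commute)
  ultimately show ?thesis
    using that BH BW by blast
qed

lemma orthogonal_matrix_adapted_to_subspace: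
  fixes H :: "(real^'n::finite) set"
  assumes "subspace H"
  obtains Q :: "real^'n^'n" and K :: "'n set"
  where "orthogonal_matrix Q" "card K = dim H" "\<And>s i. s \<in> H \<Longrightarrow> i \<notin> K \<Longrightarrow> (Q *v s) $ i = 0"
proof -
  obtain BH BW where BH: "BH \<subseteq> H" "card BH = dim H" and BW: "BW \<subseteq> H\<^sup>\<bottom>"
    and card: "card (BH \<union> BW) = CARD('n)"
    and orth: "pairwise orthogonal (BH \<union> BW)" "\<And>x. x \<in> BH \<union> BW \<Longrightarrow> norm x = 1"
    using orthonormal_basis_adapted_to_subspace [OF assms] by (metis DIM_cart DIM_real mult_1_right)
  have "finite (BH \<union> BW)"
    using card card_ge_0_finite [of "BH \<union> BW"] by simp
  then obtain e where e: "bij_betw e (UNIV :: 'n set) (BH \<union> BW)"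
    using finite_same_card_bij [OF finite_class.finite_UNIV] card by metis
  define K where "K = {i. e i \<in> BH}"
  define Q :: "real^'n^'n" where "Q = (\<chi> i. e i)"
  have "orthogonal_matrix Q"
    unfolding orthogonal_matrix_orthonormal_rows
  proof (intro conjI allI impI)
    show "norm (row i Q) = 1" for i
      using orth(2) bij_betwE [OF e] by (simp add: Q_def row_def)
    show "orthogonal (row i Q) (row j Q)" if "i \<noteq> j" for i j
    proof -
      have "e i \<noteq> e j" "e i \<in> BH \<union> BW" "e j \<in> BH \<union> BW"
        using e that by (auto simp: bij_betw_def inj_eq)
      then show ?thesis
        using orth(1) by (simp add: Q_def row_def pairwise_def)
    qed
  qed
  moreover have "card K = dim H"
  proof -
    have "e ` K = BH"
      using e by (auto simp: K_def bij_betw_def)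
    then show ?thesis
      using e BH(2) by (metis bij_betw_def card_image inj_on_subset subset_UNIV)
  qed
  moreover have "(Q *v s) $ i = 0" if "s \<in> H" "i \<notin> K" for s i
  proof -
    have "e i \<in> H\<^sup>\<bottom>"
      using that(2) e BW by (auto simp: K_def bij_betw_def)
    then show ?thesis
      using \<open>s \<in> H\<close> by (simp add: Q_def matrix_vector_mult_def orthogonal_comp_def orthogonal_def
          inner_vec_def mult.commute)
  qed
  ultimately show ?thesis
    using that by blast
qed

lemma norm_diff_cube_center_le:
  fixes s :: "real^'n::finite"
  assumes "\<forall>i. 0 \<le> s $ i \<and> s $ i \<le> b"
  shows "norm (s - (\<chi> i. b / 2)) \<le> sqrt CARD('n) * b / 2"
proof -
  have "norm (s - (\<chi> i. b / 2)) = L2_set (\<lambda>i. \<bar>s $ i - b / 2\<bar>) UNIV"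
    by (simp add: norm_vec_def L2_set_def)
  also have "\<dots> \<le> L2_set (\<lambda>_::'n. b / 2) UNIV"
    using assms by (intro L2_set_mono) (auto simp: abs_if)
  also have "\<dots> = sqrt CARD('n) * b / 2"
    using assms by (auto simp: L2_set_constant)
  finally show ?thesis .
qed

lemma orthogonal_matrix_component_le_norm:
  "orthogonal_matrix Q \<Longrightarrow> \<bar>(Q *v u) $ i\<bar> \<le> norm u"
  using component_le_norm_cart [of "Q *v u" i]
    orthogonal_transformation_norm [of "(*v) Q"] orthogonal_transformation_matrix [of "(*v) Q"]
  by simp

lemma adapted_coordinates_near_subspace_cube:
  fixes H :: "(real^'n::finite) set"
  assumes Q: "orthogonal_matrix Q" and QH: "\<And>s i. s \<in> H \<Longrightarrow> i \<notin> K \<Longrightarrow> (Q *v s) $ i = 0"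
    and s: "s \<in> H" "\<forall>i. 0 \<le> s $ i \<and> s $ i \<le> b" and "dist y s \<le> r"
  shows "\<bar>(Q *v y) $ i - (if i \<in> K then (Q *v (\<chi> j. b / 2)) $ i else 0)\<bar>
    \<le> (if i \<in> K then sqrt CARD('n) * (b / 2 + r) else r)"
proof (cases "i \<in> K")
  case True
  have "0 \<le> r"
    using \<open>dist y s \<le> r\<close> zero_le_dist [of y s] by linarith
  then have "r \<le> sqrt CARD('n) * r"
    using mult_right_mono [of 1 "sqrt CARD('n)" r] by simp
  moreover have "norm (y - (\<chi> j. b / 2)) \<le> r + sqrt CARD('n) * b / 2"
    using norm_triangle_ineq [of "y - s" "s - (\<chi> j. b / 2)"] norm_diff_cube_center_le [OF s(2)]
      \<open>dist y s \<le> r\<close> by (simp add: dist_norm)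
  ultimately show ?thesis
    using True orthogonal_matrix_component_le_norm [OF Q, of "y - (\<chi> j. b / 2)" i]
    by (simp add: matrix_vector_mult_diff_distrib algebra_simps)
next
  case False
  then show ?thesis
    using orthogonal_matrix_component_le_norm [OF Q, of "y - s" i] QH [OF s(1) False] \<open>dist y s \<le> r\<close>
    by (simp add: matrix_vector_mult_diff_distrib dist_norm)
qed

lemma measure_tube_subspace_cube:
  fixes H :: "(real^'n::finite) set"
  assumes "subspace H" "0 \<le> b" "0 \<le> r"
  obtains R where "R \<in> lmeasurable"
    "(\<Union>s \<in> H \<inter> {x. \<forall>i. 0 \<le> x $ i \<and> x $ i \<le> b}. cball s r) \<subseteq> R"
    "measure lebesgue R \<le> (sqrt CARD('n) * (b + 2 * r)) ^ dim H * (2 * r) ^ (CARD('n) - dim H)"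
proof -
  \<comment> \<open>In orthonormal coordinates adapted to H the tube lies in a box: a coordinate along H stays
     within \<open>\<surd>n (b/2 + r)\<close> of that of the centre of the cube, the others within r of 0.\<close>
  obtain Q K where Q: "orthogonal_matrix Q" and "card K = dim H"
    and QH: "\<And>s i. s \<in> H \<Longrightarrow> i \<notin> K \<Longrightarrow> (Q *v s) $ i = 0"
    using orthogonal_matrix_adapted_to_subspace [OF assms(1)] by blast
  define P where "P = transpose Q"
  have P: "orthogonal_transformation ((*v) P)" "P ** Q = mat 1"
    using Q orthogonal_matrix [of Q] by (simp_all add: P_def orthogonal_transformation_matrix)
  define m :: "real^'n" where "m = (\<chi> i. if i \<in> K then (Q *v (\<chi> j. b / 2)) $ i else 0)"
  define d :: "real^'n" where "d = (\<chi> i. if i \<in> K then sqrt CARD('n) * (b / 2 + r) else r)"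
  have box_ne: "cbox (m - d) (m + d) \<noteq> {}"
    using assms by (auto simp: box_ne_empty cart_eq_inner_axis [symmetric] Basis_vec_def d_def)
  have "measure lebesgue (cbox (m - d) (m + d)) = (\<Prod>i\<in>UNIV. 2 * d $ i)"
    using box_ne by (simp add: content_cbox_cart)
  also have "\<dots> = (\<Prod>i\<in>UNIV. if i \<in> K then sqrt CARD('n) * (b + 2 * r) else 2 * r)"
    by (intro prod.cong) (auto simp: d_def algebra_simps)
  also have "\<dots> = (sqrt CARD('n) * (b + 2 * r)) ^ dim H * (2 * r) ^ (CARD('n) - dim H)"
    using \<open>card K = dim H\<close> card_Diff_subset [of K UNIV]
    by (simp add: prod.If_cases Compl_eq_Diff_UNIV)
  finally have box: "measure lebesgue (cbox (m - d) (m + d)) = \<dots>" .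
  show ?thesis
  proof
    show "(*v) P ` cbox (m - d) (m + d) \<in> lmeasurable"
      and "measure lebesgue ((*v) P ` cbox (m - d) (m + d))
             \<le> (sqrt CARD('n) * (b + 2 * r)) ^ dim H * (2 * r) ^ (CARD('n) - dim H)"
      using measure_linear_image_cart [OF orthogonal_transformation_linear [OF P(1)] lmeasurable_cbox]
        orthogonal_transformation_det [OF P(1)] box by simp_all
    show "(\<Union>s \<in> H \<inter> {x. \<forall>i. 0 \<le> x $ i \<and> x $ i \<le> b}. cball s r) \<subseteq> (*v) P ` cbox (m - d) (m + d)"
    proof clarify
      fix s y
      assume "s \<in> H" "\<forall>i. 0 \<le> s $ i \<and> s $ i \<le> b" "y \<in> cball s r"
      then have "Q *v y \<in> cbox (m - d) (m + d)"
        using adapted_coordinates_near_subspace_cube [OF Q QH]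
        by (simp add: mem_box_cart abs_le_iff m_def d_def dist_commute algebra_simps)
      moreover have "y = P *v (Q *v y)"
        using P(2) by (simp add: matrix_vector_mul_assoc)
      ultimately show "y \<in> (*v) P ` cbox (m - d) (m + d)"
        by blast
    qed
  qed
qed

context lattice_basis
begin

lemma abs_det_basis_map_pos: "0 < \<bar>det (matrix (basis_map bs))\<bar>"
  using det_nz_iff_inj [OF linear_basis_map [of bs]] inj_basis_map by simp

lemma card_mul_det_le_measure:
  assumes "S \<subseteq> L" "R \<in> lmeasurable" "(\<Union>s\<in>S. cball s (covering_radius L)) \<subseteq> R"
  shows "real (card S) * \<bar>det (matrix (basis_map bs))\<bar> \<le> measure lebesgue R"
proof (cases "finite S")
  case True
  have cells: "voronoi_cell L s \<in> lmeasurable" if "s \<in> S" for s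
    using that assms(1) voronoi_cell_lmeasurable by blast
  have "real (card S) * \<bar>det (matrix (basis_map bs))\<bar> \<le> real (card S) * measure lebesgue (voronoi_cell L 0)"
    using det_le_measure_voronoi_cell by (simp add: mult_left_mono)
  also have "\<dots> = (\<Sum>s\<in>S. measure lebesgue (voronoi_cell L s))"
    using assms(1) measure_voronoi_cell by (simp add: subset_iff)
  also have "\<dots> = measure lebesgue (\<Union>s\<in>S. voronoi_cell L s)"
    using True assms(1) cells voronoi_cells_disjoint [of _ L]
    by (intro measure_UNION' [symmetric]) (auto simp: pairwise_def subset_iff)
  also have "\<dots> \<le> measure lebesgue R"
  proof (rule measure_mono_fmeasurable [OF _ _ assms(2)])
    show "(\<Union>s\<in>S. voronoi_cell L s) \<subseteq> R"
      using assms(1,3) dist_le_covering_radius by (fastforce simp: dist_commute)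
    show "(\<Union>s\<in>S. voronoi_cell L s) \<in> sets lebesgue"
      using True cells by (intro sets.finite_UN) (auto simp: fmeasurable_def)
  qed
  finally show ?thesis .
qed (simp add: measure_nonneg)

end

lemma full_rank_latticeE:
  assumes "full_rank_lattice L"
  obtains bs where "is_lattice_basis bs L" "covolume L = \<bar>det (matrix (basis_map bs))\<bar>"
proof
  show "is_lattice_basis (SOME bs. is_lattice_basis bs L) L"
    using assms unfolding full_rank_lattice_def by (rule someI_ex)
  show "covolume L = \<bar>det (matrix (basis_map (SOME bs. is_lattice_basis bs L)))\<bar>"
    by (simp add: covolume_def matrix_basis_map det_transpose)
qed

theorem lemma7p2:
  fixes L H :: "(real^'n) set" and b :: real and k :: nat
  assumes "full_rank_lattice L"
    and "b > 0"
    and "subspace H" and "dim H = k"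
    and "1 \<le> k" and "k < CARD('n)"
  shows "real (card (L \<inter> H \<inter> {x. \<forall>i. 0 \<le> x $ i \<and> x $ i < b}))
         \<le> real CARD('n) powr (real k / 2) * (b + 2 * covering_radius L) ^ k
            * (2 * covering_radius L) ^ (CARD('n) - k) / covolume L"
proof -
  obtain bs where "is_lattice_basis bs L" and cov: "covolume L = \<bar>det (matrix (basis_map bs))\<bar>"
    using full_rank_latticeE [OF assms(1)] by blast
  interpret lattice_basis bs L
    by (rule lattice_basis.intro) fact
  let ?\<nu> = "covering_radius L" and ?S = "L \<inter> H \<inter> {x. \<forall>i. 0 \<le> x $ i \<and> x $ i < b}"
  obtain R where R: "R \<in> lmeasurable" "(\<Union>s \<in> H \<inter> {x. \<forall>i. 0 \<le> x $ i \<and> x $ i \<le> b}. cball s ?\<nu>) \<subseteq> R"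
    and "measure lebesgue R \<le> (sqrt CARD('n) * (b + 2 * ?\<nu>)) ^ k * (2 * ?\<nu>) ^ (CARD('n) - k)"
    using measure_tube_subspace_cube [OF assms(3) less_imp_le [OF assms(2)] covering_radius_nonneg]
    unfolding assms(4) by blast
  moreover have "?S \<subseteq> L" "(\<Union>s\<in>?S. cball s ?\<nu>) \<subseteq> R"
    using R(2) by (auto intro: less_imp_le)
  then have "real (card ?S) * covolume L \<le> measure lebesgue R"
    using card_mul_det_le_measure [OF _ R(1)] by (simp add: cov)
  moreover have "sqrt CARD('n) ^ k = real CARD('n) powr (real k / 2)"
    by (simp add: powr_half_sqrt [symmetric] powr_realpow [symmetric] powr_powr)
  ultimately show ?thesis
    using abs_det_basis_map_pos by (simp add: cov pos_le_divide_eq power_mult_distrib)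
qed

end
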